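(* Let $W(t)=(W_1(t),\ldots,W_d(t))$ be a $d$-dimensional Wiener process with independent components and consider the stochastic Burgers equation in $\mathbb{R}^d$ $$\frac{\partial v^{\mu}}{\partial t}+(v^{\mu}\cdot\nabla)v^{\mu}=\frac{\mu^2}{2}\Delta v^{\mu}-\epsilon\dot W(t),\qquad v^\mu(x,0)=\nabla S_0(x)+O(\mu^2),$$ whose flow map is assumed globally reducible. The zeta process for this equation is $$\zeta_t^c=f^0_{(x_t^0(\lambda),t)}(\lambda_1)-\epsilon\,x_t^0(\lambda)\cdot W(t)+\epsilon^2\,W(t)\cdot\int_0^tW(s)\,ds-\frac{\epsilon^2}{2}\int_0^t|W(s)|^2\,ds-c,$$ where $f^0_{(x,t)}(\lambda_1)$ is the deterministic ($\epsilon=0$) reduced action function, $x_t^0(\lambda)$ is the (pre-parameterised) deterministic ($\epsilon=0$) caustic, and $\lambda$ must satisfy the stochastic equation $$\nabla_\lambda\left(f^0_{(x_t^0(\lambda),t)}(\lambda_1)-\epsilon\,x_t^0(\lambda)\cdot W(t)\right)=0.$$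
   Context: **Action and flow.** $S_0:\mathbb{R}^d\to\mathbb{R}$ is as smooth as needed and $W(0)=0$. For $x_0,x\in\mathbb{R}^d$ let $X$ be the path with $d\dot X(s)=-\epsilon\,dW(s)$, $X(0)=x_0$, $X(t)=x$. The stochastic action is $$\mathcal{A}^\epsilon(x_0,x,t)=\frac12\int_0^t|\dot X(s)|^2ds-\epsilon\int_0^tX(s)\cdot dW(s)+S_0(x_0).$$ The flow map $\Phi_t^\epsilon$ is given by $d\dot\Phi_s=-\epsilon\,dW(s)$, $\Phi_0=\mathrm{id}$, $\dot\Phi_0=\nabla S_0$. One has $x=\Phi^\epsilon_t(x_0)$ if and only if $\nabla_{x_0}\mathcal{A}^\epsilon(x_0,x,t)=0$. **Global reducibility and reduced action.** $\Phi^\epsilon_t$ is globally reducible if there is a chain of $C^2$ functions $x_0^\alpha=x_0^\alpha(x,x_0^1,\ldots,x_0^{\alpha-1},t)$, $\alpha=d,d-1,\ldots,2$, such that, for each such $\alpha$, after substituting the functions already obtained for $x_0^{\alpha+1},\ldots,x_0^d$ into $\mathcal{A}^\epsilon$, the equation $\partial\mathcal{A}^\epsilon/\partial x_0^\alpha=0$ holds if and only if $x_0^\alpha=x_0^\alpha(x,x_0^1,\ldots,x_0^{\alpha-1},t)$. The reduced action function is $$f^\epsilon_{(x,t)}(x_0^1)=\mathcal{A}^\epsilon(x_0^1,x_0^2(x,x_0^1,t),\ldots,x_0^d(\ldots),x,t).$$ **Caustic.** The pre-caustic is $\{x_0:\det(\partial\Phi_t^\epsilon(x_0)/\partial x_0)=0\}$,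 parameterised as $x_0=(\lambda_1,\ldots,\lambda_{d-1},x_{0,C}^d(\lambda))$, $\lambda=(\lambda_1,\ldots,\lambda_{d-1})\in\mathbb{R}^{d-1}$. The pre-parameterisation of the caustic is $x_t^\epsilon(\lambda)=\Phi_t^\epsilon(\lambda,x_{0,C}^d(\lambda))$. The pre-caustic and its parameterisation are taken the same for $\epsilon$ and $\epsilon=0$. **Zeta process.** For $c\in\mathbb{R}$, the zeta process is $\zeta_t^c:=f^\epsilon_{(x_t^\epsilon(\lambda),t)}(\lambda_1)-c$, where $\lambda$ satisfies $\frac{\partial}{\partial\lambda_\alpha}\big[f^\epsilon_{(x^\epsilon_t(\lambda),t)}(\lambda_1)\big]=0$ for $\alpha=1,\ldots,d-1$. (For genuine turbulence $x_t^\epsilon(\lambda)$ is in addition required to lie on the cool part of the caustic, i.e. $\lambda_1$ minimises $f^\epsilon_{(x_t^\epsilon(\lambda),t)}$ among its real critical points.) *)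

theory Defs
  imports "HOL-Probability.Probability"
begin

text \<open>Euclidean space of dimension \<open>d\<close> is \<open>real ^ 'n\<close> (or \<open>'n rvec\<close>) with \<open>d = CARD('n)\<close>; the linear order on
  the index type numbers the coordinates \<open>1, \<dots>, d\<close>.\<close>

type_synonym 'k rvec = "(real, 'k) vec"

definition coord :: "nat \<Rightarrow> 'k::{finite,linorder}" where
  "coord k = sorted_list_of_set (UNIV :: 'k set) ! (k - 1)"

text \<open>\<open>append_coord l y\<close> is \<open>(l_1, \<dots>, l_{d-1}, y)\<close>; it is meaningful when
  \<open>CARD('n) = CARD('m) + 1\<close>.\<close>

definition append_coord ::
    "real ^ 'm::{finite,linorder} \<Rightarrow> real \<Rightarrow> real ^ 'n::{finite,linorder}" where
  "append_coord l y =
     (\<chi> i. if i = coord CARD('n) then y else l $ coord (card {j. j \<le> i}))"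

definition has_partial :: "(real ^ 'k \<Rightarrow> real) \<Rightarrow> 'k \<Rightarrow> real ^ 'k \<Rightarrow> real \<Rightarrow> bool" where
  "has_partial f i x D \<longleftrightarrow> ((\<lambda>r. f (x + r *\<^sub>R axis i 1)) has_real_derivative D) (at 0)"

definition C2 :: "('a::real_normed_vector \<Rightarrow> 'b::real_normed_vector) \<Rightarrow> bool" where
  "C2 f \<longleftrightarrow> (\<exists>(f' :: 'a \<Rightarrow> 'a \<Rightarrow>\<^sub>L 'b) (f'' :: 'a \<Rightarrow> 'a \<Rightarrow>\<^sub>L 'a \<Rightarrow>\<^sub>L 'b).
     (\<forall>x. (f has_derivative blinfun_apply (f' x)) (at x)) \<and>
     (\<forall>x. (f' has_derivative blinfun_apply (f'' x)) (at x)) \<and>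
     continuous_on UNIV f'')"

definition wiener_process_1 :: "'w measure \<Rightarrow> (real \<Rightarrow> 'w \<Rightarrow> real) \<Rightarrow> bool" where
  "wiener_process_1 M B \<longleftrightarrow>
     prob_space M \<and>
     (\<forall>t\<ge>0. B t \<in> borel_measurable M) \<and>
     (AE \<omega> in M. B 0 \<omega> = 0) \<and>
     (AE \<omega> in M. continuous_on {0..} (\<lambda>t. B t \<omega>)) \<and>
     (\<forall>s t. 0 \<le> s \<and> s < t \<longrightarrow>
        distributed M lborel (\<lambda>\<omega>. B t \<omega> - B s \<omega>) (normal_density 0 (sqrt (t - s)))) \<and>
     (\<forall>n (\<tau> :: nat \<Rightarrow> real). 0 \<le> \<tau> 0 \<and> (\<forall>j<n. \<tau> j < \<tau> (Suc j)) \<longrightarrow>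
        prob_space.indep_vars M (\<lambda>_. borel) (\<lambda>j \<omega>. B (\<tau> (Suc j)) \<omega> - B (\<tau> j) \<omega>) {..<n})"

definition wiener_process :: "'w measure \<Rightarrow> (real \<Rightarrow> 'w \<Rightarrow> real ^ 'n) \<Rightarrow> bool" where
  "wiener_process M W \<longleftrightarrow>
     (\<forall>i. wiener_process_1 M (\<lambda>t \<omega>. W t \<omega> $ i)) \<and>
     prob_space.indep_vars M (\<lambda>_. PiM {0..} (\<lambda>_. borel))
       (\<lambda>i \<omega>. \<lambda>t\<in>{0..}. W t \<omega> $ i) UNIV"

text \<open>The stochastic integral of \<open>X \<cdot> dW\<close> is only needed for continuously differentiable
  \<open>X\<close>. It is then the pathwise Riemann-Stieltjes integral (the limit as the mesh tends to 0 of the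
  Riemann-Stieltjes sums with arbitrary tags), which agrees with the Ito integral, and which also
  makes sense for the path below, whose prescribed end point makes it anticipating.
  From here on \<open>w\<close> is one sample path of \<open>W\<close>.\<close>

definition has_rs_integral ::
    "(real \<Rightarrow> 'a::real_inner) \<Rightarrow> (real \<Rightarrow> 'a) \<Rightarrow> real \<Rightarrow> real \<Rightarrow> real \<Rightarrow> bool" where
  "has_rs_integral X w a b I \<longleftrightarrow>
     (\<forall>e>0. \<exists>\<delta>>0. \<forall>\<D>. \<D> tagged_division_of {a..b} \<and> (\<lambda>s. ball s \<delta>) fine \<D> \<longrightarrow>
        \<bar>(\<Sum>(s, k)\<in>\<D>. X s \<bullet> (w (Sup k) - w (Inf k))) - I\<bar> < e)"

definition rs_integral ::
    "(real \<Rightarrow> 'a::real_inner) \<Rightarrow> (real \<Rightarrow> 'a) \<Rightarrow> real \<Rightarrow> real \<Rightarrow> real" where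
  "rs_integral X w a b = (THE I. has_rs_integral X w a b I)"

text \<open>\<open>X\<close> has velocity \<open>V\<close> on \<open>[0, t]\<close> and \<open>dV(s) = - \<epsilon> dw(s)\<close>, in integrated form.\<close>

definition noisy_path ::
    "real \<Rightarrow> (real \<Rightarrow> real ^ 'n) \<Rightarrow> real \<Rightarrow> (real \<Rightarrow> real ^ 'n) \<Rightarrow> (real \<Rightarrow> real ^ 'n) \<Rightarrow> bool" where
  "noisy_path \<epsilon> w t X V \<longleftrightarrow>
     (\<forall>s\<in>{0..t}. (X has_vector_derivative V s) (at s within {0..t}) \<and>
                 V s = V 0 - \<epsilon> *\<^sub>R (w s - w 0))"

definition stochastic_action ::
    "(real ^ 'n \<Rightarrow> real) \<Rightarrow> real \<Rightarrow> (real \<Rightarrow> real ^ 'n) \<Rightarrow> real \<Rightarrow> real ^ 'n \<Rightarrow> real ^ 'n \<Rightarrow> real" where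
  "stochastic_action S0 \<epsilon> w t x0 x =
     (THE A. \<exists>X V. noisy_path \<epsilon> w t X V \<and> X 0 = x0 \<and> X t = x \<and>
        A = 1/2 * integral {0..t} (\<lambda>s. (norm (V s))\<^sup>2) - \<epsilon> * rs_integral X w 0 t + S0 x0)"

definition flow_map ::
    "(real ^ 'n \<Rightarrow> real) \<Rightarrow> real \<Rightarrow> (real \<Rightarrow> real ^ 'n) \<Rightarrow> real \<Rightarrow> real ^ 'n \<Rightarrow> real ^ 'n" where
  "flow_map S0 \<epsilon> w t x0 =
     (THE y. \<exists>X V. noisy_path \<epsilon> w t X V \<and> X 0 = x0 \<and> GDERIV S0 x0 :> V 0 \<and> X t = y)"

text \<open>Substitutes, into a point with given coordinates \<open>1, \<dots>, \<alpha>\<close>, the functions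
  \<open>g k\<close> for the coordinates \<open>k = \<alpha> + 1, \<dots>, d\<close>, in this order, since \<open>g k\<close> depends on the
  coordinates below \<open>k\<close>.\<close>

definition fill_coords ::
    "(nat \<Rightarrow> 'n::{finite,linorder} rvec \<times> 'n rvec \<Rightarrow> real) \<Rightarrow> 'n rvec \<Rightarrow> nat \<Rightarrow> 'n rvec \<Rightarrow>
     'n rvec" where
  "fill_coords g x \<alpha> y =
     fold (\<lambda>k z. \<chi> i. if i = coord k then g k (x, z) else z $ i) [Suc \<alpha>..<Suc CARD('n)] y"

text \<open>\<open>g \<alpha> (x, y)\<close> is \<open>x_0^\<alpha>(x, x_0^1, \<dots>, x_0^{\<alpha>-1}, t)\<close>, where \<open>y\<close> carries the
  coordinates of \<open>x_0\<close> and the first conjunct below says that only those with index less than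
  \<open>\<alpha>\<close> matter. The time \<open>t\<close> is fixed, so regularity is in the space variables (the action is
  in general not differentiable in \<open>t\<close>).\<close>

definition reduction_chain ::
    "('n::{finite,linorder} rvec \<Rightarrow> real) \<Rightarrow> real \<Rightarrow> (real \<Rightarrow> 'n rvec) \<Rightarrow> real \<Rightarrow>
     (nat \<Rightarrow> 'n rvec \<times> 'n rvec \<Rightarrow> real) \<Rightarrow> bool" where
  "reduction_chain S0 \<epsilon> w t g \<longleftrightarrow>
     (\<forall>\<alpha>\<in>{2..CARD('n)}.
        (\<forall>x y y'. (\<forall>\<beta>\<in>{1..<\<alpha>}. y $ coord \<beta> = y' $ coord \<beta>) \<longrightarrow> g \<alpha> (x, y) = g \<alpha> (x, y')) \<and>
        C2 (g \<alpha>) \<and>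
        (\<forall>x y. has_partial (\<lambda>y. stochastic_action S0 \<epsilon> w t (fill_coords g x \<alpha> y) x) (coord \<alpha>) y 0
               \<longleftrightarrow> y $ coord \<alpha> = g \<alpha> (x, y)))"

definition globally_reducible ::
    "('n::{finite,linorder} rvec \<Rightarrow> real) \<Rightarrow> real \<Rightarrow> (real \<Rightarrow> 'n rvec) \<Rightarrow> real \<Rightarrow> bool" where
  "globally_reducible S0 \<epsilon> w t \<longleftrightarrow> (\<exists>g. reduction_chain S0 \<epsilon> w t g)"

text \<open>The chain is uniquely determined at the indices \<open>2, \<dots>, d\<close>, so the choice below is
  immaterial, as are the coordinates other than the first of the starting point.\<close>

definition reduced_action ::
    "('n::{finite,linorder} rvec \<Rightarrow> real) \<Rightarrow> real \<Rightarrow> (real \<Rightarrow> 'n rvec) \<Rightarrow> real \<Rightarrow>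
     'n rvec \<Rightarrow> real \<Rightarrow> real" where
  "reduced_action S0 \<epsilon> w t x a =
     stochastic_action S0 \<epsilon> w t
       (fill_coords (SOME g. reduction_chain S0 \<epsilon> w t g) x 1 (axis (coord 1) a)) x"

definition pre_caustic ::
    "('n::{finite,linorder} rvec \<Rightarrow> real) \<Rightarrow> real \<Rightarrow> (real \<Rightarrow> 'n rvec) \<Rightarrow> real \<Rightarrow> 'n rvec set" where
  "pre_caustic S0 \<epsilon> w t =
     {x0. det (jacobian (flow_map S0 \<epsilon> w t) (at x0)) = 0}"

definition caustic_param ::
    "('n::{finite,linorder} rvec \<Rightarrow> real) \<Rightarrow> real \<Rightarrow> (real \<Rightarrow> 'n rvec) \<Rightarrow> real \<Rightarrow>
     ('m::{finite,linorder} rvec \<Rightarrow> real) \<Rightarrow> 'm rvec \<Rightarrow> 'n rvec" where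
  "caustic_param S0 \<epsilon> w t xC l = flow_map S0 \<epsilon> w t (append_coord l (xC l))"

text \<open>The critical parameter \<open>l\<close> need not be unique, so the zeta process is a relation:
  \<open>z\<close> is the value of the zeta process at time \<open>t\<close> belonging to the parameter \<open>l\<close>.\<close>

definition is_zeta ::
    "('n::{finite,linorder} rvec \<Rightarrow> real) \<Rightarrow> real \<Rightarrow> (real \<Rightarrow> 'n rvec) \<Rightarrow> real \<Rightarrow>
     ('m::{finite,linorder} rvec \<Rightarrow> real) \<Rightarrow> real \<Rightarrow> 'm rvec \<Rightarrow> real \<Rightarrow> bool" where
  "is_zeta S0 \<epsilon> w t xC c l z \<longleftrightarrow>
     z = reduced_action S0 \<epsilon> w t (caustic_param S0 \<epsilon> w t xC l) (l $ coord 1) - c \<and>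
     (\<forall>\<alpha>. has_partial
        (\<lambda>l. reduced_action S0 \<epsilon> w t (caustic_param S0 \<epsilon> w t xC l) (l $ coord 1)) \<alpha> l 0)"

text \<open>The deterministic objects: \<open>\<epsilon> = 0\<close>, in which case the driving path is irrelevant.\<close>

definition reduced_action0 ::
    "('n::{finite,linorder} rvec \<Rightarrow> real) \<Rightarrow> real \<Rightarrow> 'n rvec \<Rightarrow> real \<Rightarrow> real" where
  "reduced_action0 S0 t = reduced_action S0 0 (\<lambda>_. 0) t"

definition caustic_param0 ::
    "('n::{finite,linorder} rvec \<Rightarrow> real) \<Rightarrow> real \<Rightarrow>
     ('m::{finite,linorder} rvec \<Rightarrow> real) \<Rightarrow> 'm rvec \<Rightarrow> 'n rvec" where
  "caustic_param0 S0 t = caustic_param S0 0 (\<lambda>_. 0) t"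

end

theory Submission
  imports Defs
begin

text \<open>For a continuous path \<open>w\<close> with \<open>w 0 = 0\<close> put \<open>I = \<integral>\<^sub>0\<^sup>t w(s) ds\<close>. The path from \<open>x0\<close> to \<open>x\<close>
  is unique and has initial velocity \<open>(x + \<epsilon> I - x0) / t\<close>. Integrating \<open>\<integral> X \<cdot> dw\<close> by parts, the terms
  linear in \<open>w\<close> cancel, and the action becomes
  \<open>|x + \<epsilon> I - x0|\<^sup>2 / (2t) + S0 x0 - \<epsilon> x \<cdot> w(t) - \<epsilon>\<^sup>2/2 \<integral> |w|\<^sup>2\<close>. So, up to a term not depending on \<open>x0\<close>,
  the noise only shifts \<open>x\<close> by \<open>\<epsilon> I\<close>; hence it shifts the reduction chain in the same way, and the reduced
  action is shifted accordingly. The flow, and with it the caustic, is shifted by \<open>- \<epsilon> I\<close>, so on the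
  caustic the two shifts cancel and only terms independent of \<open>\<lambda>\<close> and \<open>- \<epsilon> x \<cdot> w(t)\<close> remain.\<close>

section \<open>Pathwise Riemann-Stieltjes integrals against a continuous path\<close>

lemma has_rs_integral_unique:
  assumes "has_rs_integral X w a b I" "has_rs_integral X w a b J"
  shows "I = J"
proof (rule ccontr)
  assume "I \<noteq> J"
  define e where "e = \<bar>I - J\<bar> / 2"
  have "e > 0" using \<open>I \<noteq> J\<close> by (simp add: e_def)
  obtain d1 where d1: "d1 > 0"
    "\<And>D. D tagged_division_of {a..b} \<Longrightarrow> (\<lambda>s. ball s d1) fine D \<Longrightarrow>
      \<bar>(\<Sum>(s, k)\<in>D. X s \<bullet> (w (Sup k) - w (Inf k))) - I\<bar> < e"
    using assms(1)[unfolded has_rs_integral_def, rule_format, OF \<open>e > 0\<close>] by auto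
  obtain d2 where d2: "d2 > 0"
    "\<And>D. D tagged_division_of {a..b} \<Longrightarrow> (\<lambda>s. ball s d2) fine D \<Longrightarrow>
      \<bar>(\<Sum>(s, k)\<in>D. X s \<bullet> (w (Sup k) - w (Inf k))) - J\<bar> < e"
    using assms(2)[unfolded has_rs_integral_def, rule_format, OF \<open>e > 0\<close>] by auto
  \<comment> \<open>By Cousin's lemma some tagged division is fine for both gauges. Its single
    Riemann-Stieltjes sum would then lie within half of \<open>\<bar>I - J\<bar>\<close> of both
    \<open>I\<close> and \<open>J\<close>.\<close>
  have "gauge (\<lambda>s::real. ball s (min d1 d2))"
    using d1(1) d2(1) by (simp add: gauge_def)
  then obtain D where D: "D tagged_division_of {a..b}" "(\<lambda>s. ball s (min d1 d2)) fine D"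
    using fine_division_exists_real by blast
  have "(\<lambda>s. ball s d1) fine D" "(\<lambda>s. ball s d2) fine D"
    using D(2) unfolding fine_def by fastforce+
  with d1(2)[OF D(1)] d2(2)[OF D(1)] show False
    unfolding e_def by (smt (verit) field_sum_of_halves)
qed

lemma rs_integral_eqI: "has_rs_integral X w a b I \<Longrightarrow> rs_integral X w a b = I"
  unfolding rs_integral_def using has_rs_integral_unique by blast

text \<open>The smoothness of \<open>X\<close> compensates for the possibly infinite variation of
  \<open>w\<close>. The value is the increment over \<open>{a..b}\<close> of
  \<open>X \<bullet> w - H\<close>, where \<open>H\<close> is a primitive of
  \<open>V \<bullet> w\<close>; this increment telescopes over any division, so it suffices to
  compare it with the Riemann-Stieltjes sum one tagged interval at a time.\<close>

lemma has_rs_integral_by_parts: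
  fixes X V w :: "real \<Rightarrow> 'a::euclidean_space"
  assumes "a \<le> b"
    and X: "\<And>s. s \<in> {a..b} \<Longrightarrow> (X has_vector_derivative V s) (at s within {a..b})"
    and V: "continuous_on {a..b} V"
    and w: "continuous_on {a..b} w"
  shows "has_rs_integral X w a b
    (X b \<bullet> w b - X a \<bullet> w a - integral {a..b} (\<lambda>s. V s \<bullet> w s))"
  unfolding has_rs_integral_def
proof (intro allI impI)
  fix e :: real assume "e > 0"
  have "bounded (V ` {a..b})"
    using V by (intro compact_imp_bounded compact_continuous_image) auto
  then obtain B where B: "B > 0" "\<And>s. s \<in> {a..b} \<Longrightarrow> norm (V s) \<le> B"
    unfolding bounded_pos by blast
  \<comment> \<open>The local errors are at most \<open>B * \<eta>\<close> times the length and add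
    up to \<open>B * \<eta> * (b - a)\<close>. The \<open>+ 1\<close> keeps the denominator positive
    when \<open>a = b\<close> and makes the final bound strict.\<close>
  define \<eta> where "\<eta> = e / (B * (b - a + 1))"
  have \<eta>: "\<eta> > 0" "B * \<eta> * (b - a) < e"
  proof -
    have pos: "B * (b - a + 1) > 0" using B(1) \<open>a \<le> b\<close> by simp
    with \<open>e > 0\<close> show "\<eta> > 0" by (simp add: \<eta>_def)
    have "B * \<eta> * (b - a) < \<eta> * (B * (b - a + 1))"
      using B(1) \<open>\<eta> > 0\<close> by (simp add: algebra_simps)
    also have "\<dots> = e" using pos by (metis \<eta>_def less_irrefl nonzero_eq_divide_eq)
    finally show "B * \<eta> * (b - a) < e" .
  qed
  have "uniformly_continuous_on {a..b} w"
    using w by (intro compact_uniformly_continuous) auto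
  then obtain d where d: "d > 0"
    "\<And>r r'. r \<in> {a..b} \<Longrightarrow> r' \<in> {a..b} \<Longrightarrow> dist r' r < d \<Longrightarrow> dist (w r') (w r) < \<eta>"
    unfolding uniformly_continuous_on_def using \<eta>(1) by metis
  define H where "H = (\<lambda>r. integral {a..r} (\<lambda>s. V s \<bullet> w s))"
  have H: "(H has_vector_derivative V r \<bullet> w r) (at r within {a..b})" if "r \<in> {a..b}" for r
    unfolding H_def using that V w
    by (intro integral_has_vector_derivative continuous_intros)
  \<comment> \<open>With \<open>w\<close> frozen at \<open>c\<close>, the function
    \<open>X r \<bullet> w c - H r\<close> has derivative \<open>V r \<bullet> (w c - w r)\<close>,
    which is small because \<open>w\<close> oscillates little on \<open>{p..q}\<close>.\<close>
  have est: "\<bar>(X q - X p) \<bullet> w c - (H q - H p)\<bar> \<le> B * \<eta> * (q - p)"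
    if pq: "a \<le> p" "p \<le> q" "q \<le> b" and c: "\<And>r. r \<in> {p..q} \<Longrightarrow> norm (w c - w r) \<le> \<eta>" for p q c
  proof -
    have "((\<lambda>r. X r \<bullet> w c - H r) has_vector_derivative V r \<bullet> w c - V r \<bullet> w r) (at r within {p..q})"
      if "r \<in> {p..q}" for r
    proof -
      have "r \<in> {a..b}" "{p..q} \<subseteq> {a..b}" using that pq by auto
      note * = has_vector_derivative_within_subset[OF X[OF this(1)] this(2)]
        has_vector_derivative_within_subset[OF H[OF this(1)] this(2)]
      show ?thesis
        by (intro has_vector_derivative_diff *(2)
            bounded_linear.has_vector_derivative[OF bounded_linear_inner_left *(1)])
    qed
    then have "((\<lambda>r. V r \<bullet> w c - V r \<bullet> w r) has_integral
        (X q \<bullet> w c - H q) - (X p \<bullet> w c - H p)) {p..q}"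
      using pq by (intro fundamental_theorem_of_calculus) auto
    moreover have "norm (V r \<bullet> w c - V r \<bullet> w r) \<le> B * \<eta>" if "r \<in> {p..q}" for r
    proof -
      have "norm (V r \<bullet> (w c - w r)) \<le> norm (V r) * norm (w c - w r)"
        by (simp add: Cauchy_Schwarz_ineq2)
      also have "\<dots> \<le> B * \<eta>"
        using B(1) B(2)[of r] c[OF that] that pq by (intro mult_mono) auto
      finally show ?thesis by (simp add: inner_diff_right)
    qed
    ultimately have "norm ((X q \<bullet> w c - H q) - (X p \<bullet> w c - H p)) \<le> B * \<eta> * measure lborel {p..q}"
      using B(1) \<eta>(1) by (intro has_integral_bound_real) auto
    then show ?thesis using pq by (simp add: inner_diff_left algebra_simps)
  qed
  define F where "F = (\<lambda>r. X r \<bullet> w r - H r)"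
  show "\<exists>\<delta>>0. \<forall>D. D tagged_division_of {a..b} \<and> (\<lambda>s. ball s \<delta>) fine D \<longrightarrow>
    \<bar>(\<Sum>(s, k)\<in>D. X s \<bullet> (w (Sup k) - w (Inf k))) -
      (X b \<bullet> w b - X a \<bullet> w a - integral {a..b} (\<lambda>s. V s \<bullet> w s))\<bar> < e"
  proof (intro exI[of _ "d / 2"] conjI allI impI)
    show "d / 2 > 0" using d(1) by simp
    fix D assume "D tagged_division_of {a..b} \<and> (\<lambda>s. ball s (d / 2)) fine D"
    then have D: "D tagged_division_of {a..b}" and fine: "(\<lambda>s. ball s (d / 2)) fine D" by auto
    have bound: "\<bar>X s \<bullet> (w (Sup k) - w (Inf k)) - (F (Sup k) - F (Inf k))\<bar>
        \<le> B * \<eta> * (Sup k - Inf k)" if sk: "(s, k) \<in> D" for s k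
    proof -
      obtain u v where k: "k = {u..v}"
        using tagged_division_ofD(4)[OF D sk] by auto
      have s: "s \<in> {u..v}" and sub: "{u..v} \<subseteq> {a..b}"
        using tagged_division_ofD(2,3)[OF D sk] k by auto
      have uv: "Inf k = u" "Sup k = v" "a \<le> u" "u \<le> s" "s \<le> v" "v \<le> b"
        using s sub k by auto
      have ball: "{u..v} \<subseteq> ball s (d / 2)" using fine sk k unfolding fine_def by blast
      have osc: "norm (w c - w r) \<le> \<eta>" if "c \<in> {u..v}" "r \<in> {u..v}" for c r
      proof -
        \<comment> \<open>Fineness controls distances to the tag only; halving \<open>d\<close>
          controls the distance of two arbitrary points of the interval.\<close>
        have "dist s c < d / 2" "dist s r < d / 2" using that ball by auto
        then have "dist c r < d" by (metis dist_commute dist_triangle_half_l)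
        then show ?thesis using d(2)[of r c] that sub by (auto simp: dist_norm)
      qed
      \<comment> \<open>Abel summation on one interval: it is split at the tag \<open>s\<close>, and
        \<open>w\<close> is frozen at the outer end point of each half.\<close>
      have "\<bar>(X v - X s) \<bullet> w v - (H v - H s)\<bar> \<le> B * \<eta> * (v - s)"
        "\<bar>(X s - X u) \<bullet> w u - (H s - H u)\<bar> \<le> B * \<eta> * (s - u)"
        using uv by (auto intro!: est osc)
      moreover have "X s \<bullet> (w v - w u) - (F v - F u) =
          - ((X v - X s) \<bullet> w v - (H v - H s)) - ((X s - X u) \<bullet> w u - (H s - H u))"
        by (simp add: F_def algebra_simps inner_diff_left inner_diff_right)
      moreover have "B * \<eta> * (v - s) + B * \<eta> * (s - u) = B * \<eta> * (v - u)"
        by (simp add: algebra_simps)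
      ultimately show ?thesis unfolding uv(1,2) by linarith
    qed
    have tele: "(\<Sum>(s, k)\<in>D. F (Sup k) - F (Inf k)) = F b - F a"
      by (rule additive_tagged_division_1[OF \<open>a \<le> b\<close> D])
    have "\<bar>(\<Sum>(s, k)\<in>D. X s \<bullet> (w (Sup k) - w (Inf k))) - (F b - F a)\<bar>
        = \<bar>\<Sum>(s, k)\<in>D. X s \<bullet> (w (Sup k) - w (Inf k)) - (F (Sup k) - F (Inf k))\<bar>"
      unfolding tele[symmetric] sum_subtractf[symmetric] by (simp add: split_beta)
    also have "\<dots> \<le> (\<Sum>(s, k)\<in>D. \<bar>X s \<bullet> (w (Sup k) - w (Inf k)) - (F (Sup k) - F (Inf k))\<bar>)"
      by (simp add: split_beta)
    also have "\<dots> \<le> (\<Sum>(s, k)\<in>D. B * \<eta> * (Sup k - Inf k))"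
      using bound by (intro sum_mono) auto
    also have "\<dots> = B * \<eta> * (b - a)"
      unfolding additive_tagged_division_1[OF \<open>a \<le> b\<close> D, of "\<lambda>x. x", symmetric]
      by (simp add: sum_distrib_left split_beta)
    finally show "\<bar>(\<Sum>(s, k)\<in>D. X s \<bullet> (w (Sup k) - w (Inf k))) -
      (X b \<bullet> w b - X a \<bullet> w a - integral {a..b} (\<lambda>s. V s \<bullet> w s))\<bar> < e"
      using \<eta>(2) by (simp add: F_def H_def algebra_simps)
  qed
qed

section \<open>Closed forms of the action and of the flow\<close>

lemma noisy_path_deriv:
  "noisy_path \<epsilon> w t X V \<Longrightarrow> s \<in> {0..t} \<Longrightarrow> (X has_vector_derivative V s) (at s within {0..t})"
  unfolding noisy_path_def by blast

lemma noisy_path_velocity: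
  assumes "noisy_path \<epsilon> w t X V" "w 0 = 0" "s \<in> {0..t}"
  shows "V s = V 0 - \<epsilon> *\<^sub>R w s"
  using assms unfolding noisy_path_def by (metis diff_zero)

text \<open>For \<open>t > 0\<close> this makes prescribing the end point equivalent to prescribing
  the initial velocity, so both boundary value and initial value problems have unique
  answers.\<close>

lemma noisy_path_endpoint:
  fixes w :: "real \<Rightarrow> real ^ 'n"
  assumes "noisy_path \<epsilon> w t X V" "t > 0" "continuous_on {0..t} w" "w 0 = 0"
  shows "X t = X 0 + t *\<^sub>R V 0 - \<epsilon> *\<^sub>R integral {0..t} w"
proof -
  have "(V has_integral X t - X 0) {0..t}"
    using assms(2) noisy_path_deriv[OF assms(1)] by (intro fundamental_theorem_of_calculus) auto
  moreover have "((\<lambda>s. V 0 - \<epsilon> *\<^sub>R w s) has_integral t *\<^sub>R V 0 - \<epsilon> *\<^sub>R integral {0..t} w) {0..t}"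
    using has_integral_const_real[of "V 0" 0 t] assms
    by (intro has_integral_diff has_integral_cmul integrable_integral integrable_continuous_real)
      auto
  then have "(V has_integral t *\<^sub>R V 0 - \<epsilon> *\<^sub>R integral {0..t} w) {0..t}"
    by (rule has_integral_eq[rotated]) (rule noisy_path_velocity[OF assms(1,4), symmetric])
  ultimately have "X t - X 0 = t *\<^sub>R V 0 - \<epsilon> *\<^sub>R integral {0..t} w"
    by (rule has_integral_unique)
  then show ?thesis by (simp add: algebra_simps)
qed

lemma noisy_path_exists:
  fixes w :: "real \<Rightarrow> real ^ 'n"
  assumes "continuous_on {0..t} w" "w 0 = 0"
  shows "\<exists>X V. noisy_path \<epsilon> w t X V \<and> X 0 = x0 \<and> V 0 = v"
proof (intro exI conjI)
  let ?X = "\<lambda>s. x0 + s *\<^sub>R v - \<epsilon> *\<^sub>R integral {0..s} w"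
  let ?V = "\<lambda>s. v - \<epsilon> *\<^sub>R w s"
  show "noisy_path \<epsilon> w t ?X ?V"
    unfolding noisy_path_def
  proof (intro ballI conjI)
    fix s assume s: "s \<in> {0..t}"
    have "((\<lambda>s. x0 + s *\<^sub>R v) has_vector_derivative v) (at s within {0..t})"
      by (auto intro!: derivative_eq_intros)
    moreover have "((\<lambda>s. \<epsilon> *\<^sub>R integral {0..s} w) has_vector_derivative \<epsilon> *\<^sub>R w s) (at s within {0..t})"
      using integral_has_vector_derivative[OF assms(1) s]
      by (rule bounded_linear.has_vector_derivative[OF bounded_linear_scaleR_right])
    ultimately show "(?X has_vector_derivative ?V s) (at s within {0..t})"
      by (rule has_vector_derivative_diff)
    show "?V s = ?V 0 - \<epsilon> *\<^sub>R (w s - w 0)" by (simp add: assms(2))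
  qed
qed (simp_all add: assms)

lemma noisy_path_action:
  fixes w :: "real \<Rightarrow> real ^ 'n"
  assumes path: "noisy_path \<epsilon> w t X V" and t: "t > 0"
    and w: "continuous_on {0..t} w" and w0: "w 0 = 0"
  shows "1/2 * integral {0..t} (\<lambda>s. (norm (V s))\<^sup>2) - \<epsilon> * rs_integral X w 0 t =
    t / 2 * (norm (V 0))\<^sup>2 - \<epsilon> * (X t \<bullet> w t) - \<epsilon>\<^sup>2 / 2 * integral {0..t} (\<lambda>s. (norm (w s))\<^sup>2)"
proof -
  have V: "V s = V 0 - \<epsilon> *\<^sub>R w s" if "s \<in> {0..t}" for s
    using noisy_path_velocity[OF path w0 that] .
  have Vc: "continuous_on {0..t} V"
    by (subst continuous_on_cong[OF refl V]) (auto intro!: continuous_intros w)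
  have rs: "rs_integral X w 0 t = X t \<bullet> w t - integral {0..t} (\<lambda>s. V s \<bullet> w s)"
    using has_rs_integral_by_parts[OF less_imp_le[OF t] noisy_path_deriv[OF path] Vc w] w0
    by (intro rs_integral_eqI) simp
  have int: "(\<lambda>s. (norm (V s))\<^sup>2) integrable_on {0..t}" "(\<lambda>s. V s \<bullet> w s) integrable_on {0..t}"
    "(\<lambda>s. (norm (w s))\<^sup>2) integrable_on {0..t}"
    using Vc w by (auto intro!: integrable_continuous_real continuous_intros)
  \<comment> \<open>Completing the square: the sum of the three integrands is half the squared norm
    of \<open>V s + \<epsilon> *\<^sub>R w s\<close>, and this vector is the constant
    \<open>V 0\<close>. The middle term comes from integrating the stochastic integral by
    parts.\<close>
  have "1/2 * integral {0..t} (\<lambda>s. (norm (V s))\<^sup>2) + \<epsilon> * integral {0..t} (\<lambda>s. V s \<bullet> w s)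
      + \<epsilon>\<^sup>2 / 2 * integral {0..t} (\<lambda>s. (norm (w s))\<^sup>2)
      = integral {0..t} (\<lambda>s. 1/2 * (norm (V s))\<^sup>2 + \<epsilon> * (V s \<bullet> w s) + \<epsilon>\<^sup>2 / 2 * (norm (w s))\<^sup>2)"
    by (intro integral_unique[symmetric] has_integral_add has_integral_mult_right
        integrable_integral int)
  also have "\<dots> = integral {0..t} (\<lambda>s. 1/2 * (norm (V 0))\<^sup>2)"
  proof (rule integral_cong)
    fix s assume "s \<in> {0..t}"
    show "1/2 * (norm (V s))\<^sup>2 + \<epsilon> * (V s \<bullet> w s) + \<epsilon>\<^sup>2 / 2 * (norm (w s))\<^sup>2
      = 1/2 * (norm (V 0))\<^sup>2"
      unfolding V[OF \<open>s \<in> {0..t}\<close>] power2_norm_eq_inner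
      by (simp add: inner_diff_left inner_diff_right inner_commute
          algebra_simps power2_eq_square)
  qed
  also have "\<dots> = t / 2 * (norm (V 0))\<^sup>2" using t by simp
  finally show ?thesis unfolding rs by (simp add: algebra_simps)
qed

lemma stochastic_action_eq:
  fixes w :: "real \<Rightarrow> real ^ 'n"
  assumes t: "t > 0" and w: "continuous_on {0..t} w" and w0: "w 0 = 0"
  shows "stochastic_action S0 \<epsilon> w t x0 x =
    (norm (x + \<epsilon> *\<^sub>R integral {0..t} w - x0))\<^sup>2 / (2 * t) + S0 x0
    - \<epsilon> * (x \<bullet> w t) - \<epsilon>\<^sup>2 / 2 * integral {0..t} (\<lambda>s. (norm (w s))\<^sup>2)" (is "_ = ?A")
proof -
  \<comment> \<open>The initial velocity forced by the end points, obtained by solving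
    \<open>noisy_path_endpoint\<close> for \<open>V 0\<close>.\<close>
  define v where "v = (1 / t) *\<^sub>R (x + \<epsilon> *\<^sub>R integral {0..t} w - x0)"
  have tv: "t *\<^sub>R v = x + \<epsilon> *\<^sub>R integral {0..t} w - x0" using t by (simp add: v_def)
  have A: "1/2 * integral {0..t} (\<lambda>s. (norm (V s))\<^sup>2) - \<epsilon> * rs_integral X w 0 t + S0 x0 = ?A"
    if path: "noisy_path \<epsilon> w t X V" and X: "X 0 = x0" "X t = x" for X V
  proof -
    have "t *\<^sub>R V 0 = x + \<epsilon> *\<^sub>R integral {0..t} w - x0"
      using noisy_path_endpoint[OF path t w w0] X by (simp add: algebra_simps)
    then have "(norm (x + \<epsilon> *\<^sub>R integral {0..t} w - x0))\<^sup>2 = t\<^sup>2 * (norm (V 0))\<^sup>2"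
      by (simp add: power_mult_distrib flip: \<open>t *\<^sub>R V 0 = _\<close>)
    then have "t / 2 * (norm (V 0))\<^sup>2 = (norm (x + \<epsilon> *\<^sub>R integral {0..t} w - x0))\<^sup>2 / (2 * t)"
      using t by (simp add: power2_eq_square)
    then show ?thesis using noisy_path_action[OF path t w w0] X by simp
  qed
  obtain X V where XV: "noisy_path \<epsilon> w t X V" "X 0 = x0" "V 0 = v"
    using noisy_path_exists[OF w w0] by blast
  have "X t = x"
    using noisy_path_endpoint[OF XV(1) t w w0] XV tv by (simp add: algebra_simps)
  show ?thesis
    unfolding stochastic_action_def
  proof (rule the_equality)
    show "\<exists>X V. noisy_path \<epsilon> w t X V \<and> X 0 = x0 \<and> X t = x \<and>
        ?A = 1/2 * integral {0..t} (\<lambda>s. (norm (V s))\<^sup>2) - \<epsilon> * rs_integral X w 0 t + S0 x0"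
      using XV \<open>X t = x\<close> A by metis
  qed (use A in blast)
qed

lemma flow_map_eq:
  fixes w :: "real \<Rightarrow> real ^ 'n"
  assumes t: "t > 0" and w: "continuous_on {0..t} w" and w0: "w 0 = 0"
    and v: "GDERIV S0 x0 :> v"
  shows "flow_map S0 \<epsilon> w t x0 = x0 + t *\<^sub>R v - \<epsilon> *\<^sub>R integral {0..t} w"
  unfolding flow_map_def
proof (rule the_equality)
  obtain X V where XV: "noisy_path \<epsilon> w t X V" "X 0 = x0" "V 0 = v"
    using noisy_path_exists[OF w w0] by blast
  with noisy_path_endpoint[OF XV(1) t w w0] v
  show "\<exists>X V. noisy_path \<epsilon> w t X V \<and> X 0 = x0 \<and> GDERIV S0 x0 :> V 0 \<and>
      X t = x0 + t *\<^sub>R v - \<epsilon> *\<^sub>R integral {0..t} w"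
    by auto
next
  fix y assume "\<exists>X V. noisy_path \<epsilon> w t X V \<and> X 0 = x0 \<and> GDERIV S0 x0 :> V 0 \<and> X t = y"
  then obtain X V where XV: "noisy_path \<epsilon> w t X V" "X 0 = x0" "GDERIV S0 x0 :> V 0" "X t = y"
    by blast
  \<comment> \<open>Gradients at one point represent the same derivative, so every admissible path
    starts with velocity \<open>v\<close>; this gives uniqueness for the definite
    description.\<close>
  have "(\<lambda>h. h \<bullet> V 0) = (\<lambda>h. h \<bullet> v)"
    using XV(3) v unfolding gderiv_def by (rule has_derivative_unique)
  then have "V 0 = v" by (metis inner_commute vector_eq_rdot)
  then show "y = x0 + t *\<^sub>R v - \<epsilon> *\<^sub>R integral {0..t} w"
    using noisy_path_endpoint[OF XV(1) t w w0] XV by simp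
qed

section \<open>Gradients, translations and partial derivatives\<close>

text \<open>Riesz representation of the derivative in the standard basis. It supplies the initial
  velocity that \<open>flow_map\<close> requires.\<close>

lemma differentiable_imp_GDERIV:
  fixes f :: "'a::euclidean_space \<Rightarrow> real"
  assumes "f differentiable (at x)"
  shows "\<exists>v. GDERIV f x :> v"
proof -
  obtain f' where f': "(f has_derivative f') (at x)"
    using assms by (auto simp: differentiable_def)
  then have lin: "linear f'" by (rule has_derivative_linear)
  have "f' = (\<lambda>h. h \<bullet> (\<Sum>b\<in>Basis. f' b *\<^sub>R b))"
  proof
    fix h
    have "f' h = f' (\<Sum>b\<in>Basis. (h \<bullet> b) *\<^sub>R b)" by (simp add: euclidean_representation)
    also have "\<dots> = (\<Sum>b\<in>Basis. (h \<bullet> b) * f' b)"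
      by (simp add: linear_sum[OF lin] linear_cmul[OF lin])
    finally show "f' h = h \<bullet> (\<Sum>b\<in>Basis. f' b *\<^sub>R b)"
      by (simp add: inner_sum_right mult.commute)
  qed
  with f' have "GDERIV f x :> (\<Sum>b\<in>Basis. f' b *\<^sub>R b)"
    unfolding gderiv_def by metis
  then show ?thesis ..
qed

lemma C2_imp_differentiable: "C2 f \<Longrightarrow> f differentiable (at x)"
  unfolding C2_def differentiable_def by blast

lemma C2_translate:
  assumes "C2 f"
  shows "C2 (\<lambda>x. f (x + c))"
proof -
  obtain f' f'' where f: "\<And>x. (f has_derivative blinfun_apply (f' x)) (at x)"
    "\<And>x. (f' has_derivative blinfun_apply (f'' x)) (at x)" "continuous_on UNIV f''"
    using assms unfolding C2_def by blast
  have shift: "((\<lambda>x. x + c) has_derivative (\<lambda>h. h)) (at x)" for x :: 'a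
    by (auto intro!: derivative_eq_intros)
  have "((\<lambda>x. f (x + c)) has_derivative blinfun_apply (f' (x + c))) (at x)"
    "((\<lambda>x. f' (x + c)) has_derivative blinfun_apply (f'' (x + c))) (at x)" for x
    using has_derivative_compose[OF shift f(1)] has_derivative_compose[OF shift f(2)] by auto
  moreover have "continuous_on UNIV (\<lambda>x. f'' (x + c))"
    by (rule continuous_on_compose2[OF f(3)]) (auto intro!: continuous_intros)
  ultimately show ?thesis
    unfolding C2_def
    by (intro exI[of _ "\<lambda>x. f' (x + c)"] exI[of _ "\<lambda>x. f'' (x + c)"]) blast
qed

lemma has_partial_diff_const [simp]: "has_partial (\<lambda>y. f y - c) i x D \<longleftrightarrow> has_partial f i x D"
proof -
  have "DERIV (\<lambda>y. g y - c) z :> D" if "DERIV g z :> D" for g :: "real \<Rightarrow> real" and c z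
    using DERIV_diff[OF that DERIV_const] by simp
  \<comment> \<open>The instance with \<open>- c\<close> undoes the subtraction and yields the
    forward implication.\<close>
  from this[of "\<lambda>r. f (x + r *\<^sub>R axis i 1) - c" _ "- c"] this show ?thesis
    unfolding has_partial_def by auto
qed

section \<open>Uniqueness and translation of reduction chains\<close>

lemma coord_inj:
  assumes "coord j = (coord k :: 'k::{finite,linorder})" "j \<in> {1..CARD('k)}" "k \<in> {1..CARD('k)}"
  shows "j = k"
proof -
  \<comment> \<open>Subtraction on \<open>nat\<close> makes 0 and 1 name the same coordinate; the
    range assumptions exclude 0.\<close>
  have "j - 1 = k - 1"
    using assms nth_eq_iff_index_eq[of "sorted_list_of_set (UNIV :: 'k set)" "j - 1" "k - 1"]
    unfolding coord_def by auto
  with assms show ?thesis by auto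
qed

lemma fill_coords_cong:
  fixes g g' :: "nat \<Rightarrow> 'n::{finite,linorder} rvec \<times> 'n rvec \<Rightarrow> real"
  assumes "\<And>k. \<alpha> < k \<Longrightarrow> k \<le> CARD('n) \<Longrightarrow> g k = g' k"
  shows "fill_coords g x \<alpha> y = fill_coords g' x \<alpha> y"
  unfolding fill_coords_def
proof (intro fold_cong refl)
  fix k assume "k \<in> set [Suc \<alpha>..<Suc CARD('n)]"
  then have eq: "g k = g' k" by (intro assms) auto
  show "(\<lambda>z. \<chi> i. if i = coord k then g k (x, z) else z $ i) =
      (\<lambda>z. \<chi> i. if i = coord k then g' k (x, z) else z $ i)"
    unfolding eq ..
qed

text \<open>Downward induction from \<open>\<alpha> = d\<close>: once the functions above
  \<open>\<alpha>\<close> agree, both chains substitute the same point, so the equations for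
  coordinate \<open>\<alpha>\<close> have the same solutions, and these determine
  \<open>g \<alpha>\<close>.\<close>

lemma reduction_chain_unique:
  fixes g g' :: "nat \<Rightarrow> 'n::{finite,linorder} rvec \<times> 'n rvec \<Rightarrow> real"
  assumes g: "reduction_chain S0 \<epsilon> w t g" and g': "reduction_chain S0 \<epsilon> w t g'"
    and "\<alpha> \<in> {2..CARD('n)}"
  shows "g \<alpha> = g' \<alpha>"
  using assms(3)
proof (induction "CARD('n) - \<alpha>" arbitrary: \<alpha> rule: less_induct)
  case less
  note g\<alpha> = bspec[OF g[unfolded reduction_chain_def] less.prems]
  note g'\<alpha> = bspec[OF g'[unfolded reduction_chain_def] less.prems]
  have fill: "fill_coords g x \<alpha> y = fill_coords g' x \<alpha> y" for x y
    using less by (intro fill_coords_cong) auto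
  have eq: "y $ coord \<alpha> = g \<alpha> (x, y) \<longleftrightarrow> y $ coord \<alpha> = g' \<alpha> (x, y)" for x y
  proof -
    have "has_partial (\<lambda>y. stochastic_action S0 \<epsilon> w t (fill_coords g x \<alpha> y) x) (coord \<alpha>) y 0
        \<longleftrightarrow> y $ coord \<alpha> = g \<alpha> (x, y)"
      using g\<alpha> by blast
    moreover have "has_partial (\<lambda>y. stochastic_action S0 \<epsilon> w t (fill_coords g' x \<alpha> y) x) (coord \<alpha>) y 0
        \<longleftrightarrow> y $ coord \<alpha> = g' \<alpha> (x, y)"
      using g'\<alpha> by blast
    ultimately show ?thesis unfolding fill by blast
  qed
  show ?case
  proof
    fix p :: "'n rvec \<times> 'n rvec"
    obtain x y where p: "p = (x, y)" by fastforce
    \<comment> \<open>Since \<open>g \<alpha>\<close> ignores coordinate \<open>\<alpha>\<close>,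
      overwriting it with the value of \<open>g \<alpha>\<close> produces a solution of the equation
      for \<open>g\<close>, hence also of the one for \<open>g'\<close>.\<close>
    define y' where "y' = (\<chi> i. if i = coord \<alpha> then g \<alpha> (x, y) else y $ i)"
    have "\<forall>\<beta>\<in>{1..<\<alpha>}. y' $ coord \<beta> = y $ coord \<beta>"
    proof
      fix \<beta> assume "\<beta> \<in> {1..<\<alpha>}"
      then have "coord \<beta> \<noteq> (coord \<alpha> :: 'n)"
        using coord_inj[where 'k = 'n, of \<beta> \<alpha>] less.prems by auto
      then show "y' $ coord \<beta> = y $ coord \<beta>" by (simp add: y'_def)
    qed
    then have "g \<alpha> (x, y') = g \<alpha> (x, y)" "g' \<alpha> (x, y') = g' \<alpha> (x, y)"
      using g\<alpha> g'\<alpha> by blast+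
    moreover have "y' $ coord \<alpha> = g \<alpha> (x, y)" by (simp add: y'_def)
    ultimately show "g \<alpha> p = g' \<alpha> p" using eq[of y' x] p by simp
  qed
qed

text \<open>Filling from index 1 uses the chain only at the indices \<open>2, ..., d\<close>, where
  it is unique; so the chain picked by \<open>SOME\<close> may be replaced by any given one.\<close>

lemma reduced_action_eq:
  fixes S0 :: "'n::{finite,linorder} rvec \<Rightarrow> real"
  assumes "reduction_chain S0 \<epsilon> w t g"
  shows "reduced_action S0 \<epsilon> w t x a =
    stochastic_action S0 \<epsilon> w t (fill_coords g x 1 (axis (coord 1) a)) x"
proof -
  have "reduction_chain S0 \<epsilon> w t (SOME g. reduction_chain S0 \<epsilon> w t g)"
    using assms by (rule someI[where P = "reduction_chain S0 \<epsilon> w t"])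
  from reduction_chain_unique[OF this assms] show ?thesis
    unfolding reduced_action_def by (subst fill_coords_cong[of _ _ g]) auto
qed

text \<open>Subtracting the pair \<open>(c, 0)\<close> moves only the space argument, and in this
  form \<open>C2_translate\<close> applies to the shifted chain.\<close>

lemma fill_coords_translate:
  "fill_coords (\<lambda>k p. g k (p - (c, 0))) x \<alpha> y = fill_coords g (x - c) \<alpha> y"
  unfolding fill_coords_def diff_Pair diff_zero ..

text \<open>The term \<open>C x\<close> is constant in \<open>x0\<close> and disappears from the
  partial derivatives, so the critical equations of the second action at \<open>x\<close> are those
  of the first at \<open>x - c\<close>.\<close>

lemma reduction_chain_translate:
  fixes S0 :: "'n::{finite,linorder} rvec \<Rightarrow> real"
  assumes action: "\<And>x0 x. stochastic_action S0 \<epsilon> w t x0 x =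
      stochastic_action S0 \<epsilon>' w' t x0 (x + c) - C x"
    and g: "reduction_chain S0 \<epsilon> w t g"
  shows "reduction_chain S0 \<epsilon>' w' t (\<lambda>k p. g k (p - (c, 0)))"
  unfolding reduction_chain_def
proof (intro ballI conjI allI impI)
  fix \<alpha> assume \<alpha>: "\<alpha> \<in> {2..CARD('n)}"
  note g\<alpha> = bspec[OF g[unfolded reduction_chain_def] this]
  show "g \<alpha> ((x, y) - (c, 0)) = g \<alpha> ((x, y') - (c, 0))"
    if "\<forall>\<beta>\<in>{1..<\<alpha>}. y $ coord \<beta> = y' $ coord \<beta>" for x y y'
    using g\<alpha> that by simp
  show "C2 (\<lambda>p. g \<alpha> (p - (c, 0)))"
    using C2_translate[of "g \<alpha>" "- (c, 0)"] g\<alpha> by (simp del: uminus_Pair)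
  show "has_partial (\<lambda>y. stochastic_action S0 \<epsilon>' w' t
        (fill_coords (\<lambda>k p. g k (p - (c, 0))) x \<alpha> y) x) (coord \<alpha>) y 0 \<longleftrightarrow>
      y $ coord \<alpha> = g \<alpha> ((x, y) - (c, 0))" for x y
  proof -
    have "has_partial (\<lambda>y. stochastic_action S0 \<epsilon> w t (fill_coords g (x - c) \<alpha> y) (x - c))
        (coord \<alpha>) y 0 \<longleftrightarrow> y $ coord \<alpha> = g \<alpha> (x - c, y)"
      using g\<alpha> by blast
    then show ?thesis unfolding fill_coords_translate action by simp
  qed
qed

text \<open>Reducibility of one action suffices, because the translated chain witnesses that of the
  other; both reduced actions are then evaluated at the same filled point.\<close>

lemma reduced_action_translate:
  fixes S0 :: "'n::{finite,linorder} rvec \<Rightarrow> real"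
  assumes action: "\<And>x0 x. stochastic_action S0 \<epsilon> w t x0 x =
      stochastic_action S0 \<epsilon>' w' t x0 (x + c) - C x"
    and "globally_reducible S0 \<epsilon> w t"
  shows "reduced_action S0 \<epsilon> w t x a = reduced_action S0 \<epsilon>' w' t (x + c) a - C x"
proof -
  obtain g where g: "reduction_chain S0 \<epsilon> w t g"
    using assms(2) unfolding globally_reducible_def by blast
  show ?thesis
    unfolding reduced_action_eq[OF g] fill_coords_translate
      reduced_action_eq[OF reduction_chain_translate[OF action g]] action by simp
qed

section \<open>The zeta process, pathwise and almost surely\<close>

lemma is_zeta_iff:
  fixes w :: "real \<Rightarrow> real ^ 'n::{finite,linorder}"
    and xC :: "real ^ 'm::{finite,linorder} \<Rightarrow> real"
  assumes t: "t > 0" and w: "continuous_on {0..t} w" and w0: "w 0 = 0"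
    and S0: "\<And>x. S0 differentiable (at x)" and red: "globally_reducible S0 \<epsilon> w t"
  shows "is_zeta S0 \<epsilon> w t xC c l z \<longleftrightarrow>
    z = reduced_action0 S0 t (caustic_param0 S0 t xC l) (l $ coord 1)
        - \<epsilon> * (caustic_param0 S0 t xC l \<bullet> w t)
        + \<epsilon>\<^sup>2 * (w t \<bullet> integral {0..t} w)
        - \<epsilon>\<^sup>2 / 2 * integral {0..t} (\<lambda>s. (norm (w s))\<^sup>2)
        - c \<and>
    (\<forall>\<alpha>. has_partial
       (\<lambda>l. reduced_action0 S0 t (caustic_param0 S0 t xC l) (l $ coord 1)
            - \<epsilon> * (caustic_param0 S0 t xC l \<bullet> w t)) \<alpha> l 0)"
proof -
  define I where "I = integral {0..t} w"
  define K where "K = \<epsilon>\<^sup>2 / 2 * integral {0..t} (\<lambda>s. (norm (w s))\<^sup>2)"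
  have action: "stochastic_action S0 \<epsilon> w t x0 x =
      stochastic_action S0 0 (\<lambda>_. 0) t x0 (x + \<epsilon> *\<^sub>R I) - (\<epsilon> * (x \<bullet> w t) + K)" for x0 x
    by (simp add: stochastic_action_eq[OF t w w0] stochastic_action_eq[OF t] I_def K_def)
  have flow: "flow_map S0 \<epsilon> w t x0 = flow_map S0 0 (\<lambda>_. 0) t x0 - \<epsilon> *\<^sub>R I" for x0
    using differentiable_imp_GDERIV[OF S0, of x0]
    by (auto simp: flow_map_eq[OF t w w0] flow_map_eq[OF t] I_def)
  have param: "caustic_param S0 \<epsilon> w t xC l = caustic_param0 S0 t xC l - \<epsilon> *\<^sub>R I" for l
    unfolding caustic_param_def caustic_param0_def flow ..
  \<comment> \<open>The shift by \<open>\<epsilon> *\<^sub>R I\<close> in the reduced action cancels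
    the opposite shift of the caustic. The product of \<open>- \<epsilon> *\<^sub>R I\<close> with
    \<open>- \<epsilon> *\<^sub>R w t\<close> is the origin of the term
    \<open>\<epsilon>\<^sup>2 * (w t \<bullet> I)\<close>.\<close>
  have zeta: "reduced_action S0 \<epsilon> w t (caustic_param S0 \<epsilon> w t xC l) (l $ coord 1) =
      reduced_action0 S0 t (caustic_param0 S0 t xC l) (l $ coord 1)
      - \<epsilon> * (caustic_param0 S0 t xC l \<bullet> w t) - (K - \<epsilon>\<^sup>2 * (w t \<bullet> I))" for l
    unfolding reduced_action_translate[OF action red] param reduced_action0_def
    by (simp add: inner_diff_left inner_commute algebra_simps power2_eq_square)
  show ?thesis
    \<comment> \<open>The identity \<open>zeta\<close> holds for every \<open>l\<close>, so it
      rewrites the function being differentiated as well; its last bracket does not depend on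
      \<open>l\<close> and drops out of the critical equations.\<close>
    unfolding is_zeta_def zeta has_partial_diff_const I_def[symmetric] K_def[symmetric] by auto
qed

lemma wiener_process_AE_path:
  fixes W :: "real \<Rightarrow> 'w \<Rightarrow> real ^ 'n"
  assumes "wiener_process M W"
  shows "AE \<omega> in M. W 0 \<omega> = 0 \<and> continuous_on {0..} (\<lambda>t. W t \<omega>)"
proof -
  have "AE \<omega> in M. W 0 \<omega> $ i = 0 \<and> continuous_on {0..} (\<lambda>t. W t \<omega> $ i)" for i
  proof -
    have "wiener_process_1 M (\<lambda>t \<omega>. W t \<omega> $ i)"
      using assms unfolding wiener_process_def by blast
    then have "AE \<omega> in M. W 0 \<omega> $ i = 0" "AE \<omega> in M. continuous_on {0..} (\<lambda>t. W t \<omega> $ i)"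
      unfolding wiener_process_1_def by blast+
    then show ?thesis by eventually_elim simp
  qed
  then have "AE \<omega> in M. \<forall>i. W 0 \<omega> $ i = 0 \<and> continuous_on {0..} (\<lambda>t. W t \<omega> $ i)"
    \<comment> \<open>The exceptional sets of the finitely many components are merged into
      one.\<close>
    by (simp add: AE_all_countable)
  then show ?thesis
  proof eventually_elim
    case (elim \<omega>)
    then have "continuous_on {0..} (\<lambda>t. \<chi> i. W t \<omega> $ i)"
      by (intro continuous_on_vec_lambda) auto
    with elim show ?case by (simp add: vec_eq_iff)
  qed
qed

theorem theorem5p5:
  fixes M :: "'w measure"
    and W :: "real \<Rightarrow> 'w \<Rightarrow> real ^ 'n::{finite,linorder}"
    and S0 :: "real ^ 'n::{finite,linorder} \<Rightarrow> real"
    and \<epsilon> :: real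
  assumes dim: "CARD('n) = CARD('m::{finite,linorder}) + 1"
    and wiener: "wiener_process M W"
    and smooth: "C2 S0"
  shows "AE \<omega> in M. \<forall>t>0.
    globally_reducible S0 \<epsilon> (\<lambda>s. W s \<omega>) t \<longrightarrow>
    (\<forall>xC :: real ^ 'm::{finite,linorder} \<Rightarrow> real.
       pre_caustic S0 \<epsilon> (\<lambda>s. W s \<omega>) t = range (\<lambda>l. append_coord l (xC l)) \<longrightarrow>
       (\<forall>c l z. is_zeta S0 \<epsilon> (\<lambda>s. W s \<omega>) t xC c l z \<longleftrightarrow>
          z = reduced_action0 S0 t (caustic_param0 S0 t xC l) (l $ coord 1)
              - \<epsilon> * (caustic_param0 S0 t xC l \<bullet> W t \<omega>)
              + \<epsilon>\<^sup>2 * (W t \<omega> \<bullet> integral {0..t} (\<lambda>s. W s \<omega>))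
              - \<epsilon>\<^sup>2 / 2 * integral {0..t} (\<lambda>s. (norm (W s \<omega>))\<^sup>2)
              - c \<and>
          (\<forall>\<alpha>. has_partial
             (\<lambda>l. reduced_action0 S0 t (caustic_param0 S0 t xC l) (l $ coord 1)
                  - \<epsilon> * (caustic_param0 S0 t xC l \<bullet> W t \<omega>)) \<alpha> l 0)))"
  using wiener_process_AE_path[OF wiener]
proof eventually_elim
  \<comment> \<open>One null set, where the path is discontinuous or does not start at 0, serves all
    \<open>t\<close>, \<open>xC\<close>, \<open>c\<close>, \<open>l\<close> and \<open>z\<close>;
    outside it the argument is deterministic.\<close>
  case (elim \<omega>)
  have "continuous_on {0..t} (\<lambda>t. W t \<omega>)" for t
    using conjunct2[OF elim] by (rule continuous_on_subset) auto
  note zeta = is_zeta_iff[OF _ this conjunct1[OF elim] C2_imp_differentiable[OF smooth]]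
  show ?case
    by (intro allI impI zeta)
qed

end
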